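(* Consider the anisotropic TV-regularized case, i.e. $\mathcal K=\mathcal K_{\mathrm{an}}$. Assume that the iterate $\boldsymbol u_k^h:\Omega^h\to\mathbb{R}^l$ is sublabel-integral, i.e. $\boldsymbol u_k^h(x)\in\boldsymbol\Gamma$ for all $x\in\Omega^h$. Moreover, assume that $\boldsymbol p_k^h:=\nabla^\top\boldsymbol q_k^h$ is a subgradient in $\partial\boldsymbol J^h(\boldsymbol u_k^h)$, where $\boldsymbol q_k^h:\Omega^h\to\mathcal K_{\mathrm{an}}$ is a maximizer in $$\boldsymbol J^h(\boldsymbol u_k^h)=\max_{\boldsymbol q^h:\Omega^h\to\mathbb{R}^{l\times d}}\sum_{x\in\Omega^h}\Big(\langle\boldsymbol q^h(x),\nabla\boldsymbol u_k^h(x)\rangle-\delta_{\mathcal K_{\mathrm{an}}}(\boldsymbol q^h(x))\Big).$$ Define $\tilde{\boldsymbol q}_k^h:\Omega^h\to\mathbb{R}^{l\times d}$ pointwise as follows: for $x^m\in\Omega^h$ with $\boldsymbol u_k^h(x^m)=\boldsymbol 1_i^\alpha$, $$\tilde{\boldsymbol q}_k^h(x^m):=\frac{(\boldsymbol q_k^h(x^m))^i}{\gamma_{i+1}-\gamma_i}\,\tilde{\boldsymbol\gamma},$$ where $(\boldsymbol q_k^h(x^m))^i\in\mathbb{R}^d$ is the $i$-th row of $\boldsymbol q_k^h(x^m)$. Then $\tilde{\boldsymbol p}_k^h:=\nabla^\top\tilde{\boldsymbol q}_k^h$ is also a subgradient, i.e. $\tilde{\boldsymbol p}_k^h\in\partial\boldsymbol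 J^h(\boldsymbol u_k^h)$, and furthermore it is of the form $$\tilde{\boldsymbol p}_k^h=p_k^h\,\tilde{\boldsymbol\gamma},$$ where $p_k^h$ is a subgradient in the unlifted case, i.e. $p_k^h\in\partial J^h(u_k^h)$.
   Context: Setting: $\Omega^h$ is a finite discretized domain (grid) in dimension $d$ with grid spacing $h$; $\nabla$ denotes the discretized forward-difference operator (scaled by $1/h$), applied componentwise to vector-valued functions, and $\nabla^\top$ its transpose. $\delta_C$ is the indicator function ($0$ on $C$, $+\infty$ elsewhere). Lifting: the label space is $\Gamma=[\gamma_1,\gamma_L]\subset\mathbb{R}$ with labels $\gamma_1<\dots<\gamma_L$, $l:=L-1$. For $i\in\{1,\dots,l\}$, $\alpha\in[0,1]$ let $\boldsymbol 1_i^\alpha:=\alpha\boldsymbol 1_i+(1-\alpha)\boldsymbol 1_{i-1}\in\mathbb{R}^l$, where $\boldsymbol 1_i\in\mathbb{R}^l$ is $i$ ones followed by $l-i$ zeros; $\boldsymbol\Gamma:=\{\boldsymbol 1_i^\alpha: i\in\{1,\dots,l\},\alpha\in[0,1]\}$. A sublabel-integral function $\boldsymbol u^h:\Omega^h\to\boldsymbol\Gamma$ is identified with the scalar (unlifted) function $u^h(x)=\gamma_1+\sum_{i=1}^l(\boldsymbol u^h(x))^i(\gamma_{i+1}-\gamma_i)$; $u_k^h$ denotes the unlifted function corresponding to $\boldsymbol u_k^h$. Let $\tilde{\boldsymbol\gamma}:=(\gamma_2-\gamma_1,\dots,\gamma_L-\gamma_l)^\top\in\mathbb{R}^l$. The product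 of $\tilde{\boldsymbol\gamma}\in\mathbb{R}^l$ with a row vector $r\in\mathbb{R}^d$ is the $l\times d$ matrix with $j$-th row $(\gamma_{j+1}-\gamma_j)\,r$; for $p:\Omega^h\to\mathbb{R}$, $p\,\tilde{\boldsymbol\gamma}$ is the function $x\mapsto p(x)\tilde{\boldsymbol\gamma}\in\mathbb{R}^l$. Discretized lifted anisotropic total variation: $\mathcal K_{\mathrm{an}}:=\{\boldsymbol q\in\mathbb{R}^{l\times d}:\|\boldsymbol q_i\|_\infty\le\gamma_{i+1}-\gamma_i\ \forall i=1,\dots,l\}$, with $\boldsymbol q_i$ the $i$-th row of $\boldsymbol q$, and for $\boldsymbol u^h:\Omega^h\to\mathbb{R}^l$ $$\boldsymbol J^h(\boldsymbol u^h):=\max_{\boldsymbol q^h:\Omega^h\to\mathbb{R}^{l\times d}}\sum_{x\in\Omega^h}\Big(\langle\boldsymbol q^h(x),\nabla\boldsymbol u^h(x)\rangle-\delta_{\mathcal K_{\mathrm{an}}}(\boldsymbol q^h(x))\Big).$$ $\partial\boldsymbol J^h(\boldsymbol u^h)$ is the convex subdifferential of $\boldsymbol u^h\mapsto\boldsymbol J^h(\boldsymbol u^h)$. If $\boldsymbol q^h$ is a maximizer above, then $\nabla^\top\boldsymbol q^h\in\partial\boldsymbol J^h(\boldsymbol u^h)$. Unlifted discretized anisotropic total variation: for $u^h:\Omega^h\to\mathbb{R}$, $J^h(u^h):=\max\{\sum_{x\in\Omega^h}\langle q^h(x),\nabla u^h(x)\rangle: q^h:\Omega^h\to\mathbb{R}^d,\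 \|q^h(x)\|_\infty\le1\ \forall x\}$, with convex subdifferential $\partial J^h$. The iterate $\boldsymbol u_k^h$ is the $k$-th iterate of the spatially discretized lifted Bregman iteration: $\boldsymbol p_0^h=0$ and, for $k=1,2,\dots$, $\boldsymbol u_k^h\in\arg\min_{\boldsymbol u^h}\{\sum_{x\in\Omega^h}(\boldsymbol\rho^h)^{**}(x,\boldsymbol u^h(x))+\boldsymbol J^h(\boldsymbol u^h)-\langle\boldsymbol p_{k-1}^h,\boldsymbol u^h\rangle\}$ and $\boldsymbol p_k^h\in\partial\boldsymbol J^h(\boldsymbol u_k^h)$. Here $\boldsymbol\rho^h(x,\boldsymbol u):=\inf_{i\in\{1,\dots,l\},\alpha\in[0,1]}\{\rho(x,\gamma_i+\alpha(\gamma_{i+1}-\gamma_i))+\delta_{\{\boldsymbol 1_i^\alpha\}}(\boldsymbol u)\}$ for $\boldsymbol u\in\mathbb{R}^l$, with $\rho$ a proper non-negative data term, and $(\cdot)^{**}$ is the Legendre–Fenchel biconjugate in $\boldsymbol u$.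
   Formalization: Where u_k(x) is an interior label, 1_i^1 = 1_{i+1}^0, the rule for q~ gives two values and an arbitrary choice can make the claim false; the formal statement requires the rule for every representation, so there rows i and i+1 of q_k, each divided by its label difference, must agree. *)

theory Defs
  imports "HOL-Analysis.Analysis"
begin

section \<open>Convex analysis\<close>

definition delta :: "'a set \<Rightarrow> 'a \<Rightarrow> ereal" where
  "delta C y = (if y \<in> C then 0 else \<infinity>)"

definition subdifferential :: "('a::real_inner \<Rightarrow> ereal) \<Rightarrow> 'a \<Rightarrow> 'a set" where
  "subdifferential f u =
     {p. \<bar>f u\<bar> \<noteq> \<infinity> \<and> (\<forall>v. f u + ereal (inner p (v - u)) \<le> f v)}"

definition conjugate :: "('a::real_inner \<Rightarrow> ereal) \<Rightarrow> 'a \<Rightarrow> ereal" where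
  "conjugate f p = (SUP u. ereal (inner p u) - f u)"

definition biconjugate :: "('a::real_inner \<Rightarrow> ereal) \<Rightarrow> 'a \<Rightarrow> ereal" where
  "biconjugate f = conjugate (conjugate f)"


section \<open>Grid and forward differences\<close>

text \<open>The points of the finite grid are indexed by a finite type \<open>'x\<close>; \<open>pos\<close> gives their
  coordinates, so the grid itself is \<open>range pos\<close>, an arbitrary finite nonempty subset of a
  translate of the lattice of width \<open>h\<close>.  Functions on the grid with values in \<open>'a\<close> have the
  type \<open>'a ^ 'x\<close>, whose inner product is the sum over the grid of the pointwise inner
  products.\<close>

definition regular_grid :: "real \<Rightarrow> ('x::finite \<Rightarrow> real ^ 'd) \<Rightarrow> bool" where
  "regular_grid h pos \<longleftrightarrow>
     h > 0 \<and> inj pos \<and> (\<exists>a. \<forall>x j. (pos x $ j - a $ j) / h \<in> \<int>)"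

text \<open>Boundary convention (homogeneous Neumann): the difference is zero in every direction in
  which the point has no forward neighbour in the grid.\<close>

definition grad :: "real \<Rightarrow> ('x::finite \<Rightarrow> real ^ 'd) \<Rightarrow> real ^ 'x \<Rightarrow> (real ^ 'd) ^ 'x" where
  "grad h pos u = (\<chi> x j.
     let z = pos x + h *\<^sub>R axis j 1
     in if z \<in> range pos then (u $ inv pos z - u $ x) / h else 0)"

text \<open>Componentwise on vector-valued functions; the \<open>i\<close>-th row at a grid point is the gradient of
  the \<open>i\<close>-th component.  The transposes of \<open>grad\<close> and \<open>lifted_grad\<close> are their \<^const>\<open>adjoint\<close>s.\<close>

definition lifted_grad ::
  "real \<Rightarrow> ('x::finite \<Rightarrow> real ^ 'd) \<Rightarrow> (real ^ 'l) ^ 'x \<Rightarrow> (real ^ 'd ^ 'l) ^ 'x" where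
  "lifted_grad h pos u = (\<chi> x i. grad h pos (\<chi> y. u $ y $ i) $ x)"


section \<open>Lifting\<close>

text \<open>The index set \<open>{1..l}\<close> is represented by a finite linearly ordered type \<open>'l\<close> with
  \<open>l = CARD('l)\<close>; \<open>row_no i\<close> is the number in \<open>{1..l}\<close> of the index \<open>i\<close>.  Labels are a sequence
  \<open>\<gamma>\<close> of which only the values at \<open>1, \<dots>, l + 1\<close> matter.\<close>

definition row_no :: "'l::{finite,linorder} \<Rightarrow> nat" where
  "row_no i = card {j. j \<le> i}"

lemma strict_mono_row_no: "strict_mono (row_no :: 'l::{finite,linorder} \<Rightarrow> nat)"
proof (rule strict_monoI)
  fix i j :: 'l assume "i < j"
  then have "j \<in> {k. k \<le> j}" "j \<notin> {k. k \<le> i}" "{k. k \<le> i} \<subseteq> {k. k \<le> j}"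
    by (auto intro: order_trans[OF _ less_imp_le])
  then have "{k. k \<le> i} \<subset> {k. k \<le> j}" by blast
  then show "row_no i < row_no j"
    unfolding row_no_def by (intro psubset_card_mono) auto
qed

lemma bij_betw_row_no: "bij_betw row_no (UNIV :: 'l::{finite,linorder} set) {1..CARD('l)}"
proof -
  have inj: "inj (row_no :: 'l \<Rightarrow> nat)"
    using strict_mono_row_no strict_mono_imp_inj_on by blast
  have "row_no i \<in> {1..CARD('l)}" for i :: 'l
  proof -
    have "0 < card {j. j \<le> i}"
      by (subst card_gt_0_iff) auto
    moreover have "card {j. j \<le> i} \<le> CARD('l)"
      by (intro card_mono) auto
    ultimately show ?thesis by (simp add: row_no_def)
  qed
  then have "range (row_no :: 'l \<Rightarrow> nat) \<subseteq> {1..CARD('l)}" by blast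
  moreover have "card (range (row_no :: 'l \<Rightarrow> nat)) = card {1..CARD('l)}"
    by (simp add: card_image[OF inj])
  ultimately have "range (row_no :: 'l \<Rightarrow> nat) = {1..CARD('l)}"
    by (intro card_subset_eq) auto
  with inj show ?thesis by (simp add: bij_betw_def)
qed

definition ones :: "nat \<Rightarrow> real ^ 'l::{finite,linorder}" where
  "ones n = (\<chi> j. if row_no j \<le> n then 1 else 0)"

definition sublabel :: "'l::{finite,linorder} \<Rightarrow> real \<Rightarrow> real ^ 'l::{finite,linorder}" where
  "sublabel i \<alpha> = \<alpha> *\<^sub>R ones (row_no i) + (1 - \<alpha>) *\<^sub>R ones (row_no i - 1)"

text \<open>The pair \<open>(i, \<alpha>)\<close> is not determined by the vector at interior labels:
  \<open>sublabel i 1 = sublabel j 0\<close> if \<open>row_no j = row_no i + 1\<close>.\<close>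

definition sublabels :: "(real ^ 'l::{finite,linorder}) set" where
  "sublabels = {sublabel i \<alpha> | i \<alpha>. \<alpha> \<in> {0..1}}"

definition label_diffs :: "(nat \<Rightarrow> real) \<Rightarrow> real ^ 'l::{finite,linorder}" where
  "label_diffs \<gamma> = (\<chi> i. \<gamma> (row_no i + 1) - \<gamma> (row_no i))"

definition unlift :: "(nat \<Rightarrow> real) \<Rightarrow> (real ^ 'l::{finite,linorder}) ^ 'x \<Rightarrow> real ^ 'x" where
  "unlift \<gamma> u = (\<chi> x. \<gamma> 1 + (\<Sum>i\<in>UNIV. u $ x $ i * (\<gamma> (row_no i + 1) - \<gamma> (row_no i))))"

definition column_times_row :: "real ^ 'l \<Rightarrow> real ^ 'd \<Rightarrow> real ^ 'd ^ 'l" where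
  "column_times_row c r = (\<chi> j. c $ j *\<^sub>R r)"


section \<open>Lifted and unlifted anisotropic total variation\<close>

definition K_an :: "(nat \<Rightarrow> real) \<Rightarrow> (real ^ 'd ^ 'l::{finite,linorder}) set" where
  "K_an \<gamma> = {q. \<forall>i. infnorm (q $ i) \<le> \<gamma> (row_no i + 1) - \<gamma> (row_no i)}"

definition lifted_tv_objective ::
  "real \<Rightarrow> ('x::finite \<Rightarrow> real ^ 'd) \<Rightarrow> (nat \<Rightarrow> real) \<Rightarrow>
   (real ^ 'l::{finite,linorder}) ^ 'x \<Rightarrow> (real ^ 'd ^ 'l::{finite,linorder}) ^ 'x \<Rightarrow> ereal" where
  "lifted_tv_objective h pos \<gamma> u q =
     (\<Sum>x\<in>UNIV. ereal (inner (q $ x) (lifted_grad h pos u $ x)) - delta (K_an \<gamma>) (q $ x))"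

definition lifted_tv ::
  "real \<Rightarrow> ('x::finite \<Rightarrow> real ^ 'd) \<Rightarrow> (nat \<Rightarrow> real) \<Rightarrow>
   (real ^ 'l::{finite,linorder}) ^ 'x \<Rightarrow> ereal" where
  "lifted_tv h pos \<gamma> u = (SUP q. lifted_tv_objective h pos \<gamma> u q)"

definition tv :: "real \<Rightarrow> ('x::finite \<Rightarrow> real ^ 'd) \<Rightarrow> real ^ 'x \<Rightarrow> ereal" where
  "tv h pos u = (SUP q\<in>{q. \<forall>x. infnorm (q $ x) \<le> 1}.
     ereal (\<Sum>x\<in>UNIV. inner (q $ x) (grad h pos u $ x)))"


section \<open>Lifted Bregman iteration\<close>

definition data_term :: "nat \<Rightarrow> (nat \<Rightarrow> real) \<Rightarrow> ('x \<Rightarrow> real \<Rightarrow> ereal) \<Rightarrow> bool" where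
  "data_term L \<gamma> \<rho> \<longleftrightarrow>
     (\<forall>x. (\<forall>t\<in>{\<gamma> 1..\<gamma> L}. 0 \<le> \<rho> x t) \<and> (\<exists>t\<in>{\<gamma> 1..\<gamma> L}. \<rho> x t < \<infinity>))"

definition lifted_data ::
  "(nat \<Rightarrow> real) \<Rightarrow> ('x \<Rightarrow> real \<Rightarrow> ereal) \<Rightarrow> 'x \<Rightarrow> real ^ 'l::{finite,linorder} \<Rightarrow> ereal" where
  "lifted_data \<gamma> \<rho> x u = (INF (i, \<alpha>)\<in>(UNIV :: 'l set) \<times> {0..1}.
     \<rho> x (\<gamma> (row_no i) + \<alpha> * (\<gamma> (row_no i + 1) - \<gamma> (row_no i))) + delta {sublabel i \<alpha>} u)"

text \<open>\<open>u 1, \<dots>, u n\<close> and \<open>p 0, \<dots>, p n\<close> are produced by the first \<open>n\<close> steps; \<open>u 0\<close> is unused.\<close>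

definition lifted_bregman ::
  "real \<Rightarrow> ('x::finite \<Rightarrow> real ^ 'd) \<Rightarrow> (nat \<Rightarrow> real) \<Rightarrow> ('x \<Rightarrow> real \<Rightarrow> ereal) \<Rightarrow> nat \<Rightarrow>
   (nat \<Rightarrow> (real ^ 'l::{finite,linorder}) ^ 'x) \<Rightarrow> (nat \<Rightarrow> (real ^ 'l::{finite,linorder}) ^ 'x) \<Rightarrow> bool" where
  "lifted_bregman h pos \<gamma> \<rho> n u p \<longleftrightarrow>
     p 0 = 0 \<and>
     (\<forall>k\<in>{1..n}.
        is_arg_min (\<lambda>v. (\<Sum>x\<in>UNIV. biconjugate (lifted_data \<gamma> \<rho> x) (v $ x))
                          + lifted_tv h pos \<gamma> v - ereal (inner (p (k - 1)) v))
                   (\<lambda>_. True) (u k) \<and>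
        p k \<in> subdifferential (lifted_tv h pos \<gamma>) (u k))"

end

theory Submission
  imports Defs
begin

text \<open>
  The dual constraint of the anisotropic total variation acts on each entry separately, so a
  feasible field \<open>q\<close> is a maximizer for \<open>u\<close> exactly if \<open>q\<^sub>i\<^sub>j g\<^sub>i\<^sub>j = c\<^sub>i \<bar>g\<^sub>i\<^sub>j\<bar>\<close> for every entry of the
  lifted gradient \<open>g\<close>, where \<open>c\<^sub>i\<close> is the width of the \<open>i\<close>-th label interval: wherever \<open>g\<^sub>i\<^sub>j \<noteq> 0\<close>,
  the entry of \<open>q\<close> is \<open>c\<^sub>i\<close> times its sign (\<open>maximizer_entries\<close>, \<open>lifted_tv_eq_inner\<close>).

  Sublabel vectors form a chain for the componentwise order (\<open>sublabels_chain\<close>).  Hence for a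
  sublabel-integral \<open>u\<close> all entries of one column of the gradient at one grid point have the same
  sign or vanish, and one row of \<open>q\<close> in which the gradient entry does not vanish determines the optimal
  value, up to the factors \<open>c\<^sub>i\<close>, in the whole column.  The row \<open>i\<close> with \<open>u(x) = 1\<^sub>i\<^sup>\<alpha>\<close> is such a row
  for all differing neighbours at once, except at an interior label, where
  \<open>u(x) = 1\<^sub>i\<^sup>1 = 1\<^sub>i\<^sub>+\<^sub>1\<^sup>0\<close>: row \<open>i\<close> sees only smaller neighbours and row \<open>i + 1\<close> only larger ones.
  The defining equation of the modified field is required for both representations, so that the
  row that fits the neighbour can be chosen (\<open>sublabel_distinguishing_index\<close>).  Thus the modified
  field is a maximizer too, and its image under \<open>\<nabla>\<^sup>T\<close> is a subgradient.

  The modified field has the form \<open>c s(x)\<close> with \<open>s(x)\<close> bounded by 1.  Pairing such a field with a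
  lifted gradient is the same as pairing \<open>s\<close> with the gradient of the unlifted function, because
  unlifting is the inner product with \<open>c\<close> up to a constant (\<open>inner_column_field_lifted_grad\<close>).
  So every feasible scalar field gives a feasible lifted one with the same objective value, the
  optimality of \<open>c s\<close> forces that of \<open>s\<close>, and transposing the pairing gives
  \<open>\<nabla>\<^sup>T(c s) = (\<nabla>\<^sup>T s) c\<close>.
\<close>

section \<open>The discrete gradient\<close>

text \<open>Choosing \<open>y = x\<close> where there is no forward neighbour turns the boundary convention into an
  instance of the interior formula.\<close>

lemma grad_entry_difference: "\<exists>y. \<forall>u. grad h pos u $ x $ j = (u $ y - u $ x) / h"
proof (cases "pos x + h *\<^sub>R axis j 1 \<in> range pos")
  case True
  then show ?thesis
    by (intro exI[of _ "inv pos (pos x + h *\<^sub>R axis j 1)"]) (simp add: grad_def Let_def)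
next
  case False
  then show ?thesis
    by (intro exI[of _ x]) (simp add: grad_def Let_def)
qed

lemma linear_grad: "linear (grad h pos)"
proof (rule linearI)
  show "grad h pos (u + v) = grad h pos u + grad h pos v" for u v
  proof (intro vec_eq_iff[THEN iffD2] allI)
    fix x j
    obtain y where "\<And>u. grad h pos u $ x $ j = (u $ y - u $ x) / h"
      using grad_entry_difference[of h pos x j] by blast
    then show "grad h pos (u + v) $ x $ j = (grad h pos u + grad h pos v) $ x $ j"
      by (simp add: diff_divide_distrib add_divide_distrib)
  qed
  show "grad h pos (r *\<^sub>R u) = r *\<^sub>R grad h pos u" for r u
  proof (intro vec_eq_iff[THEN iffD2] allI)
    fix x j
    obtain y where "\<And>u. grad h pos u $ x $ j = (u $ y - u $ x) / h"
      using grad_entry_difference[of h pos x j] by blast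
    then show "grad h pos (r *\<^sub>R u) $ x $ j = (r *\<^sub>R grad h pos u) $ x $ j"
      by (simp add: algebra_simps)
  qed
qed

lemma lifted_grad_nth: "lifted_grad h pos u $ x $ i = grad h pos (\<chi> y. u $ y $ i) $ x"
  by (simp add: lifted_grad_def)

lemma linear_lifted_grad: "linear (lifted_grad h pos)"
proof (rule linearI)
  show "lifted_grad h pos (u + v) = lifted_grad h pos u + lifted_grad h pos v" for u v
  proof (intro vec_eq_iff[THEN iffD2] allI)
    fix x i j
    have "(\<chi> y. (u + v) $ y $ i) = (\<chi> y. u $ y $ i) + (\<chi> y. v $ y $ i)"
      by (simp add: vec_eq_iff)
    then show "lifted_grad h pos (u + v) $ x $ i $ j
        = (lifted_grad h pos u + lifted_grad h pos v) $ x $ i $ j"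
      by (simp only: lifted_grad_nth linear_add[OF linear_grad] vector_add_component)
  qed
  show "lifted_grad h pos (r *\<^sub>R u) = r *\<^sub>R lifted_grad h pos u" for r u
  proof (intro vec_eq_iff[THEN iffD2] allI)
    fix x i j
    have "(\<chi> y. (r *\<^sub>R u) $ y $ i) = r *\<^sub>R (\<chi> y. u $ y $ i)"
      by (simp add: vec_eq_iff)
    then show "lifted_grad h pos (r *\<^sub>R u) $ x $ i $ j
        = (r *\<^sub>R lifted_grad h pos u) $ x $ i $ j"
      by (simp only: lifted_grad_nth linear_cmul[OF linear_grad] vector_scaleR_component)
  qed
qed

lemma grad_unlift:
  "grad h pos (unlift \<gamma> u) = grad h pos (\<chi> x. inner (label_diffs \<gamma>) (u $ x))"
proof (intro vec_eq_iff[THEN iffD2] allI)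
  fix x j
  obtain y where "\<And>u. grad h pos u $ x $ j = (u $ y - u $ x) / h"
    using grad_entry_difference[of h pos x j] by blast
  then show "grad h pos (unlift \<gamma> u) $ x $ j
      = grad h pos (\<chi> x. inner (label_diffs \<gamma>) (u $ x)) $ x $ j"
    by (simp add: unlift_def label_diffs_def inner_vec_def mult.commute)
qed

lemma grad_inner_components:
  "grad h pos (\<chi> x. inner c (u $ x)) $ x = (\<Sum>i\<in>UNIV. c $ i *\<^sub>R lifted_grad h pos u $ x $ i)"
proof (intro vec_eq_iff[THEN iffD2] allI)
  fix j
  obtain y where "\<And>u. grad h pos u $ x $ j = (u $ y - u $ x) / h"
    using grad_entry_difference[of h pos x j] by blast
  then show "grad h pos (\<chi> x. inner c (u $ x)) $ x $ j
      = (\<Sum>i\<in>UNIV. c $ i *\<^sub>R lifted_grad h pos u $ x $ i) $ j"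
    by (simp add: inner_vec_def lifted_grad_nth right_diff_distrib sum_subtractf
        sum_divide_distrib diff_divide_distrib)
qed

text \<open>The product with a fixed column is, on fields, the transpose of the inner product with that
  column on functions; this identity transfers both optimality and the image under \<open>\<nabla>\<^sup>T\<close> between
  the lifted and the scalar setting.\<close>

lemma inner_column_field_lifted_grad:
  "inner (\<chi> x. column_times_row c (s $ x)) (lifted_grad h pos u)
     = inner s (grad h pos (\<chi> x. inner c (u $ x)))"
proof -
  have "inner (column_times_row c (s $ x)) (lifted_grad h pos u $ x)
      = inner (s $ x) (grad h pos (\<chi> x. inner c (u $ x)) $ x)" for x
    by (simp add: grad_inner_components inner_sum_right column_times_row_def
        inner_vec_def[of "\<chi> i. c $ i *\<^sub>R s $ x"])
  then show ?thesis
    by (simp add: inner_vec_def[of s] inner_vec_def[of "\<chi> x. column_times_row c (s $ x)"])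
qed

lemma adjoint_lifted_grad_column_field:
  "adjoint (lifted_grad h pos) (\<chi> x. column_times_row c (s $ x))
     = (\<chi> x. adjoint (grad h pos) s $ x *\<^sub>R c)"
proof (rule vector_eq_ldot[THEN iffD1, rule_format])
  fix w
  have "inner w (adjoint (lifted_grad h pos) (\<chi> x. column_times_row c (s $ x)))
      = inner s (grad h pos (\<chi> x. inner c (w $ x)))"
    by (simp add: adjoint_works[OF linear_lifted_grad] inner_column_field_lifted_grad
        inner_commute[of "lifted_grad h pos w"])
  also have "\<dots> = inner (\<chi> x. inner c (w $ x)) (adjoint (grad h pos) s)"
    by (simp add: adjoint_works[OF linear_grad] inner_commute[of s])
  also have "\<dots> = inner w (\<chi> x. adjoint (grad h pos) s $ x *\<^sub>R c)"
    by (simp add: inner_vec_def[of "\<chi> x. inner c (w $ x)"] inner_vec_def[of w] inner_commute[of _ c]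
        mult.commute)
  finally show "inner w (adjoint (lifted_grad h pos) (\<chi> x. column_times_row c (s $ x)))
      = inner w (\<chi> x. adjoint (grad h pos) s $ x *\<^sub>R c)" .
qed

section \<open>Sublabel vectors\<close>

lemma row_no_le_iff: "row_no m \<le> row_no i \<longleftrightarrow> m \<le> i"
  using strict_mono_row_no by (rule strict_mono_less_eq)

lemma row_no_range: "1 \<le> row_no i" "row_no (i :: 'l::{finite,linorder}) \<le> CARD('l)"
  using bij_betwE[OF bij_betw_row_no] by fastforce+

lemma label_diffs_nth: "label_diffs \<gamma> $ i = \<gamma> (row_no i + 1) - \<gamma> (row_no i)"
  by (simp add: label_diffs_def)

lemma label_diffs_pos:
  assumes "strict_mono_on {1..CARD('l) + 1} \<gamma>"
  shows "0 < label_diffs \<gamma> $ (i :: 'l::{finite,linorder})"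
  using strict_mono_onD[OF assms, of "row_no i" "row_no i + 1"] row_no_range[of i]
  by (simp add: label_diffs_nth)

lemma sublabel_nth: "sublabel i \<alpha> $ m = (if m < i then 1 else if m = i then \<alpha> else 0)"
proof -
  have "row_no m \<le> row_no i - 1 \<longleftrightarrow> m < i"
    using row_no_range(1)[of i] strict_mono_less[OF strict_mono_row_no, of m i] by linarith
  then show ?thesis
    by (auto simp: sublabel_def ones_def row_no_le_iff)
qed

lemma sublabels_chain:
  assumes "a \<in> sublabels" "b \<in> sublabels"
  shows "(\<forall>m. a $ m \<le> b $ m) \<or> (\<forall>m. b $ m \<le> a $ m)"
proof -
  obtain i \<alpha> where a: "a = sublabel i \<alpha>" "0 \<le> \<alpha>" "\<alpha> \<le> 1"
    using assms(1) by (auto simp: sublabels_def)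
  obtain j \<beta> where b: "b = sublabel j \<beta>" "0 \<le> \<beta>" "\<beta> \<le> 1"
    using assms(2) by (auto simp: sublabels_def)
  consider "i < j" | "j < i" | "i = j" "\<alpha> \<le> \<beta>" | "i = j" "\<beta> \<le> \<alpha>" by fastforce
  then show ?thesis
    using a(2,3) b(2,3) by cases (auto simp: a(1) b(1) sublabel_nth)
qed

text \<open>Only at an interior label can the given index fail, and there the vector has a second
  representation: the next index with sublabel 0 if \<open>b\<close> lies above \<open>a\<close>, and the previous one
  with sublabel 1 if it lies below.  If both indices failed, \<open>b\<close> would be that same label.\<close>

lemma sublabel_distinguishing_index:
  assumes "a \<in> sublabels" "b \<in> sublabels" "a \<noteq> b"
  obtains i \<alpha> where "\<alpha> \<in> {0..1}" "a = sublabel i \<alpha>" "b $ i \<noteq> a $ i"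
proof -
  obtain i \<alpha> where a: "a = sublabel i \<alpha>" "\<alpha> \<in> {0..1}"
    using assms(1) by (auto simp: sublabels_def)
  obtain j \<beta> where b: "b = sublabel j \<beta>" "\<beta> \<in> {0..1}"
    using assms(2) by (auto simp: sublabels_def)
  show ?thesis
  proof (cases "b $ i = a $ i")
    case False
    then show ?thesis using a that by blast
  next
    case eq: True
    have "i \<noteq> j"
      using eq assms(3) by (auto simp: a(1) b(1) sublabel_nth)
    then consider "i < j" | "j < i" by fastforce
    then show ?thesis
    proof cases
      case 1
      then have \<alpha>: "\<alpha> = 1" using eq by (simp add: a(1) b(1) sublabel_nth)
      define i' where "i' = Min {m. i < m}"
      have i': "i < i'" "\<And>m. i < m \<Longrightarrow> i' \<le> m"
        using Min_in[of "{m. i < m}", OF finite] 1 by (auto simp: i'_def simp del: Min_gr_iff)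
      have below: "m < i' \<longleftrightarrow> m \<le> i" for m
        using i' by (meson leD le_less_trans not_le)
      have a': "a = sublabel i' 0"
        by (auto simp: vec_eq_iff a(1) \<alpha> sublabel_nth below)
      have "b $ i' \<noteq> a $ i'"
      proof
        assume "b $ i' = a $ i'"
        then have "i' = j \<and> \<beta> = 0"
          using i'(2)[OF 1] by (auto simp: a' b(1) sublabel_nth split: if_splits)
        then show False using assms(3) a' b(1) by simp
      qed
      then show ?thesis using a' that[of 0] by simp
    next
      case 2
      then have \<alpha>: "\<alpha> = 0" using eq by (auto simp: a(1) b(1) sublabel_nth)
      define i' where "i' = Max {m. m < i}"
      have i': "i' < i" "\<And>m. m < i \<Longrightarrow> m \<le> i'"
        using Max_in[of "{m. m < i}", OF finite] 2 by (auto simp: i'_def simp del: Max_less_iff)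
      have below: "m < i \<longleftrightarrow> m \<le> i'" for m
        using i' by (meson le_less_trans)
      have a': "a = sublabel i' 1"
        by (auto simp: vec_eq_iff a(1) \<alpha> sublabel_nth below)
      have "b $ i' \<noteq> a $ i'"
      proof
        assume "b $ i' = a $ i'"
        then have "i' = j \<and> \<beta> = 1"
          using i'(2)[OF 2] by (auto simp: a' b(1) sublabel_nth split: if_splits)
        then show False using assms(3) a' b(1) by simp
      qed
      then show ?thesis using a' that[of 1] by simp
    qed
  qed
qed

section \<open>Dual maximizers and subgradients\<close>

lemma infnorm_le_iff_cart: "infnorm (x :: real ^ 'n) \<le> c \<longleftrightarrow> (\<forall>j. \<bar>x $ j\<bar> \<le> c)"
proof
  assume "infnorm x \<le> c"
  then show "\<forall>j. \<bar>x $ j\<bar> \<le> c"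
    using component_le_infnorm_cart order_trans by blast
next
  assume "\<forall>j. \<bar>x $ j\<bar> \<le> c"
  then show "infnorm x \<le> c"
    unfolding infnorm_cart by (intro cSup_least) auto
qed

lemma K_an_iff: "q \<in> K_an \<gamma> \<longleftrightarrow> (\<forall>i j. \<bar>q $ i $ j\<bar> \<le> label_diffs \<gamma> $ i)"
  by (simp add: K_an_def infnorm_le_iff_cart label_diffs_nth)

lemma K_an_entry_le:
  assumes "q \<in> K_an \<gamma>"
  shows "q $ i $ j * t \<le> label_diffs \<gamma> $ i * \<bar>t\<bar>"
proof -
  have "q $ i $ j * t \<le> \<bar>q $ i $ j\<bar> * \<bar>t\<bar>"
    by (metis abs_ge_self abs_mult)
  also have "\<dots> \<le> label_diffs \<gamma> $ i * \<bar>t\<bar>"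
    using assms by (intro mult_right_mono) (auto simp: K_an_iff)
  finally show ?thesis .
qed

lemma K_an_inner_le:
  assumes "q \<in> K_an \<gamma>"
  shows "inner q g \<le> (\<Sum>i\<in>UNIV. \<Sum>j\<in>UNIV. label_diffs \<gamma> $ i * \<bar>g $ i $ j\<bar>)"
  unfolding inner_vec_def inner_real_def
  by (intro sum_mono K_an_entry_le[OF assms])

lemma lifted_tv_objective_feasible:
  assumes "\<And>x. q $ x \<in> K_an \<gamma>"
  shows "lifted_tv_objective h pos \<gamma> u q = ereal (inner q (lifted_grad h pos u))"
  using assms by (simp add: lifted_tv_objective_def delta_def inner_vec_def[of q])

text \<open>Under the entrywise condition \<open>q\<close> attains, at each grid point, the upper bound over the whole
  constraint set; an infeasible competitor has the value \<open>-\<infinity>\<close>.\<close>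

lemma lifted_tv_eq_inner:
  assumes feas: "\<And>x. q $ x \<in> K_an \<gamma>"
    and entries: "\<And>x i j. q $ x $ i $ j * lifted_grad h pos u $ x $ i $ j
                     = label_diffs \<gamma> $ i * \<bar>lifted_grad h pos u $ x $ i $ j\<bar>"
  shows "lifted_tv h pos \<gamma> u = ereal (inner q (lifted_grad h pos u))"
  unfolding lifted_tv_def
proof (rule antisym[OF SUP_least])
  fix q'
  have "lifted_tv_objective h pos \<gamma> u q'
      \<le> (\<Sum>x\<in>UNIV. ereal (inner (q $ x) (lifted_grad h pos u $ x)))"
    unfolding lifted_tv_objective_def
  proof (rule sum_mono)
    fix x
    have "inner (q $ x) (lifted_grad h pos u $ x)
        = (\<Sum>i\<in>UNIV. \<Sum>j\<in>UNIV. label_diffs \<gamma> $ i * \<bar>lifted_grad h pos u $ x $ i $ j\<bar>)"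
      by (simp add: inner_vec_def entries)
    then show "ereal (inner (q' $ x) (lifted_grad h pos u $ x)) - delta (K_an \<gamma>) (q' $ x)
        \<le> ereal (inner (q $ x) (lifted_grad h pos u $ x))"
      using K_an_inner_le[of "q' $ x" \<gamma>] by (simp add: delta_def)
  qed
  then show "lifted_tv_objective h pos \<gamma> u q' \<le> ereal (inner q (lifted_grad h pos u))"
    by (simp add: inner_vec_def[of q])
next
  show "ereal (inner q (lifted_grad h pos u)) \<le> (SUP q. lifted_tv_objective h pos \<gamma> u q)"
    by (metis SUP_upper UNIV_I feas lifted_tv_objective_feasible)
qed

text \<open>The entrywise condition is also necessary: the competitor with entries \<open>c\<^sub>i sgn g\<^sub>i\<^sub>j\<close>
  attains the entrywise upper bound, so a maximizer leaves no gap in any entry.\<close>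

lemma maximizer_entries:
  fixes u :: "(real ^ 'l::{finite,linorder}) ^ 'x::finite"
  assumes pos_diffs: "\<And>i :: 'l. 0 < label_diffs \<gamma> $ i"
    and feas: "\<And>x. q $ x \<in> K_an \<gamma>"
    and max: "is_arg_max (lifted_tv_objective h pos \<gamma> u) (\<lambda>_. True) q"
  shows "q $ x $ i $ j * lifted_grad h pos u $ x $ i $ j
           = label_diffs \<gamma> $ i * \<bar>lifted_grad h pos u $ x $ i $ j\<bar>"
proof -
  define g where "g = lifted_grad h pos u"
  define qs where "qs = (\<chi> x i j. label_diffs \<gamma> $ i * sgn (g $ x $ i $ j))"
  define gap where "gap x i j = qs $ x $ i $ j * g $ x $ i $ j - q $ x $ i $ j * g $ x $ i $ j"
    for x i j
  have qs_entry: "qs $ x $ i $ j * g $ x $ i $ j = label_diffs \<gamma> $ i * \<bar>g $ x $ i $ j\<bar>" for x i j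
    by (simp add: qs_def abs_sgn mult.commute)
  have "\<bar>qs $ x $ i $ j\<bar> \<le> label_diffs \<gamma> $ i" for x i j
    using pos_diffs[of i] by (simp add: qs_def abs_mult sgn_if)
  then have qs_feas: "qs $ x \<in> K_an \<gamma>" for x
    by (simp add: K_an_iff)
  have "lifted_tv_objective h pos \<gamma> u qs \<le> lifted_tv_objective h pos \<gamma> u q"
    using max by (auto simp: is_arg_max_def not_less)
  then have "inner qs g \<le> inner q g"
    by (simp add: lifted_tv_objective_feasible[OF qs_feas] lifted_tv_objective_feasible[OF feas]
        g_def)
  then have le: "(\<Sum>x\<in>UNIV. \<Sum>i\<in>UNIV. \<Sum>j\<in>UNIV. gap x i j) \<le> 0"
    by (simp add: inner_vec_def gap_def sum_subtractf)
  have nonneg: "0 \<le> gap x i j" for x i j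
    using K_an_entry_le[OF feas] by (simp add: gap_def qs_entry)
  have "(\<Sum>x\<in>UNIV. \<Sum>i\<in>UNIV. \<Sum>j\<in>UNIV. gap x i j) = 0"
    using le by (intro antisym sum_nonneg) (auto simp: nonneg)
  then have "gap x i j = 0"
    by (simp add: sum_nonneg_eq_0_iff sum_nonneg nonneg)
  then show ?thesis
    using qs_entry[of x i j] unfolding gap_def g_def by linarith
qed

text \<open>For fixed feasible \<open>q\<close> the objective is linear in the primal variable and bounds the total
  variation from below, with equality at \<open>u\<close>.\<close>

lemma adjoint_maximizer_lifted_subgradient:
  assumes feas: "\<And>x. q $ x \<in> K_an \<gamma>"
    and attained: "lifted_tv h pos \<gamma> u = ereal (inner q (lifted_grad h pos u))"
  shows "adjoint (lifted_grad h pos) q \<in> subdifferential (lifted_tv h pos \<gamma>) u"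
proof -
  have "lifted_tv h pos \<gamma> u + ereal (inner (adjoint (lifted_grad h pos) q) (v - u))
      \<le> lifted_tv h pos \<gamma> v" for v
  proof -
    have "lifted_tv h pos \<gamma> u + ereal (inner (adjoint (lifted_grad h pos) q) (v - u))
        = lifted_tv_objective h pos \<gamma> v q"
      by (simp add: attained lifted_tv_objective_feasible[OF feas]
          adjoint_clauses[OF linear_lifted_grad] linear_diff[OF linear_lifted_grad]
          inner_diff_right)
    also have "\<dots> \<le> lifted_tv h pos \<gamma> v"
      unfolding lifted_tv_def by (intro SUP_upper) simp
    finally show ?thesis .
  qed
  then show ?thesis by (simp add: subdifferential_def attained)
qed

lemma adjoint_maximizer_subgradient:
  assumes feas: "\<And>x. infnorm (s $ x) \<le> 1"
    and attained: "tv h pos u = ereal (inner s (grad h pos u))"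
  shows "adjoint (grad h pos) s \<in> subdifferential (tv h pos) u"
proof -
  have "tv h pos u + ereal (inner (adjoint (grad h pos) s) (v - u)) \<le> tv h pos v" for v
  proof -
    have "tv h pos u + ereal (inner (adjoint (grad h pos) s) (v - u))
        = ereal (\<Sum>x\<in>UNIV. inner (s $ x) (grad h pos v $ x))"
      by (simp add: attained adjoint_clauses[OF linear_grad] linear_diff[OF linear_grad]
          inner_diff_right inner_vec_def[of s])
    also have "\<dots> \<le> tv h pos v"
      unfolding tv_def using feas by (intro SUP_upper) simp
    finally show ?thesis .
  qed
  then show ?thesis by (simp add: subdifferential_def attained)
qed

section \<open>The modified dual field\<close>

lemma column_field_feasible:
  assumes "\<And>i :: 'l::{finite,linorder}. 0 < label_diffs \<gamma> $ i" "infnorm r \<le> 1"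
  shows "column_times_row (label_diffs \<gamma> :: real ^ 'l::{finite,linorder}) r \<in> K_an \<gamma>"
  unfolding K_an_iff column_times_row_def
proof (intro allI)
  fix i :: 'l and j
  have "label_diffs \<gamma> $ i * \<bar>r $ j\<bar> \<le> label_diffs \<gamma> $ i * 1"
    using assms(1)[of i] assms(2) by (intro mult_left_mono) (auto simp: infnorm_le_iff_cart)
  then show "\<bar>(\<chi> i. label_diffs \<gamma> $ i *\<^sub>R r) $ i $ j\<bar> \<le> label_diffs \<gamma> $ i"
    using assms(1)[of i] by (simp add: abs_mult)
qed

text \<open>A feasible scalar field \<open>s'\<close> gives the feasible lifted field \<open>c s'\<close> with the same objective
  value, so it cannot beat \<open>s\<close> when \<open>c s\<close> is optimal.\<close>

lemma tv_unlift_eq_inner: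
  fixes u :: "(real ^ 'l::{finite,linorder}) ^ 'x::finite" and pos :: "'x \<Rightarrow> real ^ 'd"
  assumes pos_diffs: "\<And>i :: 'l. 0 < label_diffs \<gamma> $ i"
    and feas: "\<And>x. infnorm (s $ x) \<le> 1"
    and attained: "lifted_tv h pos \<gamma> u
      = ereal (inner (\<chi> x. column_times_row (label_diffs \<gamma>) (s $ x)) (lifted_grad h pos u))"
  shows "tv h pos (unlift \<gamma> u) = ereal (inner s (grad h pos (unlift \<gamma> u)))"
  unfolding tv_def
proof (rule antisym[OF SUP_least])
  fix s' :: "(real ^ 'd) ^ 'x" assume "s' \<in> {q. \<forall>x. infnorm (q $ x) \<le> 1}"
  then have "lifted_tv_objective h pos \<gamma> u (\<chi> x. column_times_row (label_diffs \<gamma>) (s' $ x))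
      = ereal (inner s' (grad h pos (unlift \<gamma> u)))"
    by (subst lifted_tv_objective_feasible)
      (auto simp: column_field_feasible[OF pos_diffs] inner_column_field_lifted_grad grad_unlift)
  moreover have "lifted_tv_objective h pos \<gamma> u (\<chi> x. column_times_row (label_diffs \<gamma>) (s' $ x))
      \<le> lifted_tv h pos \<gamma> u"
    unfolding lifted_tv_def by (intro SUP_upper) simp
  ultimately show "ereal (\<Sum>x\<in>UNIV. inner (s' $ x) (grad h pos (unlift \<gamma> u) $ x))
      \<le> ereal (inner s (grad h pos (unlift \<gamma> u)))"
    by (simp add: attained inner_column_field_lifted_grad grad_unlift inner_vec_def[of s'])
next
  show "ereal (inner s (grad h pos (unlift \<gamma> u)))
      \<le> (SUP q\<in>{q. \<forall>x. infnorm (q $ x) \<le> 1}.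
            ereal (\<Sum>x\<in>UNIV. inner (q $ x) (grad h pos (unlift \<gamma> u) $ x)))"
    using feas by (intro SUP_upper2[of s]) (auto simp: inner_vec_def[of s])
qed

text \<open>If the neighbour in direction \<open>j\<close> carries a different vector, some representation of \<open>u(x)\<close>
  has an index at which the gradient does not vanish; there the optimality of \<open>q\<close> makes the
  \<open>j\<close>-th entry of \<open>s(x)\<close> the sign of the gradient, and by the chain property this sign fits
  all rows.\<close>

lemma modified_field_entries:
  fixes u :: "(real ^ 'l::{finite,linorder}) ^ 'x::finite" and pos :: "'x \<Rightarrow> real ^ 'd"
  assumes h: "0 < h"
    and pos_diffs: "\<And>i :: 'l. 0 < label_diffs \<gamma> $ i"
    and integral: "\<And>x. u $ x \<in> sublabels"
    and entries: "\<And>x i j. q $ x $ i $ j * lifted_grad h pos u $ x $ i $ j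
                     = label_diffs \<gamma> $ i * \<bar>lifted_grad h pos u $ x $ i $ j\<bar>"
    and s: "\<And>x i \<alpha>. \<alpha> \<in> {0..1} \<Longrightarrow> u $ x = sublabel i \<alpha>
               \<Longrightarrow> s $ x = (1 / label_diffs \<gamma> $ i) *\<^sub>R (q $ x $ i)"
  shows "column_times_row (label_diffs \<gamma>) (s $ x) $ m $ j * lifted_grad h pos u $ x $ m $ j
           = label_diffs \<gamma> $ m * \<bar>lifted_grad h pos u $ x $ m $ j\<bar>"
proof -
  obtain y where y: "\<And>v. grad h pos v $ x $ j = (v $ y - v $ x) / h"
    using grad_entry_difference[of h pos x j] by blast
  define g where "g i = lifted_grad h pos u $ x $ i $ j" for i
  have g: "g i = (u $ y $ i - u $ x $ i) / h" for i
    by (simp add: g_def lifted_grad_nth y)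
  have "s $ x $ j * g m = \<bar>g m\<bar>"
  proof (cases "u $ x = u $ y")
    case True
    then show ?thesis by (simp add: g)
  next
    case False
    then obtain i \<alpha> where i: "\<alpha> \<in> {0..1}" "u $ x = sublabel i \<alpha>" "u $ y $ i \<noteq> u $ x $ i"
      using sublabel_distinguishing_index[OF integral integral] by blast
    have "s $ x $ j * g i = \<bar>g i\<bar>"
      using entries[of x i j] pos_diffs[of i] by (simp add: s[OF i(1,2)] g_def field_simps)
    moreover have "g i \<noteq> 0"
      using i(3) h by (simp add: g)
    ultimately have s_sgn: "s $ x $ j = sgn (g i)"
      by (metis abs_sgn mult.commute mult_right_cancel)
    have "(\<forall>n. 0 \<le> g n) \<or> (\<forall>n. g n \<le> 0)"
      using sublabels_chain[OF integral[of x] integral[of y]] h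
      by (auto simp: g divide_le_0_iff zero_le_divide_iff)
    then show ?thesis
    proof
      assume "\<forall>n. 0 \<le> g n"
      then have "0 < g i" "0 \<le> g m" using \<open>g i \<noteq> 0\<close> by (auto simp: order_less_le)
      then show ?thesis by (simp add: s_sgn)
    next
      assume "\<forall>n. g n \<le> 0"
      then have "g i < 0" "g m \<le> 0" using \<open>g i \<noteq> 0\<close> by (auto simp: order_less_le)
      then show ?thesis by (simp add: s_sgn)
    qed
  qed
  then show ?thesis by (simp add: column_times_row_def g_def)
qed

lemma column_times_row_cancel:
  assumes "c $ i \<noteq> 0" "column_times_row c r = column_times_row c r'"
  shows "r = r'"
proof -
  have "c $ i *\<^sub>R r = c $ i *\<^sub>R r'"
    using arg_cong[OF assms(2), of "\<lambda>a. a $ i"] by (simp add: column_times_row_def)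
  then show ?thesis using assms(1) by simp
qed

theorem proposition3:
  fixes h :: real
    and pos :: "'x::finite \<Rightarrow> real ^ 'd"
    and \<gamma> :: "nat \<Rightarrow> real"
    and \<rho> :: "'x \<Rightarrow> real \<Rightarrow> ereal"
    and u p :: "nat \<Rightarrow> (real ^ 'l::{finite,linorder}) ^ 'x"
    and k :: nat
    and q qt :: "(real ^ 'd ^ 'l::{finite,linorder}) ^ 'x"
  assumes grid: "regular_grid h pos"
    and labels: "strict_mono_on {1..CARD('l) + 1} \<gamma>"
    and data: "data_term (CARD('l) + 1) \<gamma> \<rho>"
    and k: "k \<ge> 1"
    and iterates: "lifted_bregman h pos \<gamma> \<rho> k u p"
    and integral: "\<forall>x. u k $ x \<in> sublabels"
    and q_K: "\<forall>x. q $ x \<in> K_an \<gamma>"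
    and q_max: "is_arg_max (lifted_tv_objective h pos \<gamma> (u k)) (\<lambda>_. True) q"
    and p_q: "p k = adjoint (lifted_grad h pos) q"
    and p_subgradient: "p k \<in> subdifferential (lifted_tv h pos \<gamma>) (u k)"
    and qt: "\<forall>x i. \<forall>\<alpha>\<in>{0..1}. u k $ x = sublabel i \<alpha> \<longrightarrow>
               qt $ x = column_times_row (label_diffs \<gamma>)
                          ((1 / (\<gamma> (row_no i + 1) - \<gamma> (row_no i))) *\<^sub>R (q $ x $ i))"
  shows "adjoint (lifted_grad h pos) qt \<in> subdifferential (lifted_tv h pos \<gamma>) (u k) \<and>
         (\<exists>pk \<in> subdifferential (tv h pos) (unlift \<gamma> (u k)).
            adjoint (lifted_grad h pos) qt = (\<chi> x. pk $ x *\<^sub>R label_diffs \<gamma>))"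
proof -
  have pos_diffs: "0 < label_diffs \<gamma> $ i" for i :: 'l
    using labels by (rule label_diffs_pos)
  have h: "0 < h"
    using grid by (simp add: regular_grid_def)
  have qt': "qt $ x = column_times_row (label_diffs \<gamma>) ((1 / label_diffs \<gamma> $ i) *\<^sub>R (q $ x $ i))"
    if "\<alpha> \<in> {0..1}" "u k $ x = sublabel i \<alpha>" for x i \<alpha>
    using qt[rule_format, OF that] by (simp add: label_diffs_nth)
  have rep: "\<exists>i. \<exists>\<alpha>\<in>{0..1}. u k $ x = sublabel i \<alpha>" for x
    using integral[rule_format, of x] unfolding sublabels_def by blast
  then have "\<exists>r. qt $ x = column_times_row (label_diffs \<gamma>) r" for x
    using qt' by blast
  then obtain r where r: "\<And>x. qt $ x = column_times_row (label_diffs \<gamma>) (r x)"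
    by metis
  define s where "s = (\<chi> x. r x)"
  have qt_s: "qt = (\<chi> x. column_times_row (label_diffs \<gamma>) (s $ x))"
    by (simp add: vec_eq_iff s_def r)
  (* The rescaled row is the same for every representation of u(x), as the column is nonzero. *)
  have s: "s $ x = (1 / label_diffs \<gamma> $ i) *\<^sub>R (q $ x $ i)"
    if "\<alpha> \<in> {0..1}" "u k $ x = sublabel i \<alpha>" for x i \<alpha>
  proof (rule column_times_row_cancel)
    show "label_diffs \<gamma> $ i \<noteq> 0" using pos_diffs[of i] by simp
    show "column_times_row (label_diffs \<gamma> :: real ^ 'l::{finite,linorder}) (s $ x)
        = column_times_row (label_diffs \<gamma>) ((1 / label_diffs \<gamma> $ i) *\<^sub>R (q $ x $ i))"
      using qt'[OF that] r[of x] by (simp add: s_def)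
  qed
  have s_feas: "infnorm (s $ x) \<le> 1" for x
  proof -
    obtain i \<alpha> where i: "\<alpha> \<in> {0..1}" "u k $ x = sublabel i \<alpha>" using rep by blast
    have "\<bar>q $ x $ i $ j\<bar> \<le> label_diffs \<gamma> $ i" for j
      using q_K by (simp add: K_an_iff)
    then show ?thesis
      using pos_diffs[of i] by (simp add: s[OF i] infnorm_le_iff_cart abs_mult field_simps)
  qed
  have qt_feas: "qt $ x \<in> K_an \<gamma>" for x
    using column_field_feasible[OF pos_diffs s_feas] by (simp add: qt_s)
  have entries: "q $ x $ i $ j * lifted_grad h pos (u k) $ x $ i $ j
      = label_diffs \<gamma> $ i * \<bar>lifted_grad h pos (u k) $ x $ i $ j\<bar>" for x i j
    using maximizer_entries[OF pos_diffs _ q_max] q_K by blast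
  have qt_entries: "qt $ x $ i $ j * lifted_grad h pos (u k) $ x $ i $ j
      = label_diffs \<gamma> $ i * \<bar>lifted_grad h pos (u k) $ x $ i $ j\<bar>" for x i j
    using modified_field_entries[OF h pos_diffs integral[rule_format] entries s]
    by (simp add: qt_s)
  have attained: "lifted_tv h pos \<gamma> (u k) = ereal (inner qt (lifted_grad h pos (u k)))"
    using qt_feas qt_entries by (rule lifted_tv_eq_inner)
  have "tv h pos (unlift \<gamma> (u k)) = ereal (inner s (grad h pos (unlift \<gamma> (u k))))"
    using pos_diffs s_feas attained[unfolded qt_s] by (rule tv_unlift_eq_inner)
  with s_feas have "adjoint (grad h pos) s \<in> subdifferential (tv h pos) (unlift \<gamma> (u k))"
    by (rule adjoint_maximizer_subgradient)
  moreover have "adjoint (lifted_grad h pos) qt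
      = (\<chi> x. adjoint (grad h pos) s $ x *\<^sub>R label_diffs \<gamma>)"
    unfolding qt_s by (rule adjoint_lifted_grad_column_field)
  moreover have "adjoint (lifted_grad h pos) qt \<in> subdifferential (lifted_tv h pos \<gamma>) (u k)"
    using qt_feas attained by (rule adjoint_maximizer_lifted_subgradient)
  ultimately show ?thesis by blast
qed

end
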